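(* Let $n\ge 2$, let $x_1,\dots,x_n$ be real numbers with $x_1+\cdots+x_n=0$, and let $X_1,\dots,X_n$ be the successive values of a sample of size $n$ drawn sequentially without replacement from $\{x_1,\dots,x_n\}$. Let $\mathcal{F}_0$ be the trivial sigma-field and $\mathcal{F}_k=\sigma(X_1,\dots,X_k)$ for $1\le k\le n$. For each $1\le k\le n$ let $a_k$ be a real-valued $\mathcal{F}_{k-1}$-measurable random variable. Put $S_k=X_1+\cdots+X_k$ and $W_k=a_1X_1+a_2X_2+\cdots+a_kX_k$. Then the process $$M_k=W_k+\frac{a_1+a_2+\cdots+a_k}{n-k}\,S_k,\qquad 1\le k<n,$$ is a martingale with respect to $\{\mathcal{F}_k:1\le k<n\}$.
   Context: Sampling without replacement: $X_i=x_{\sigma(i)}$ for $1\le i\le n$, where $\sigma$ is a uniformly distributed random permutation of $\{1,\dots,n\}$ on a finite probability space. The $x_i$ need not be distinct. *)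

theory Defs
  imports "HOL-Probability.Probability" "HOL-Combinatorics.Permutations"
begin

definition uniform_random_permutation ::
  "'a measure \<Rightarrow> nat \<Rightarrow> ('a \<Rightarrow> nat \<Rightarrow> nat) \<Rightarrow> bool" where
  "uniform_random_permutation M n \<sigma> \<longleftrightarrow>
     \<sigma> \<in> measurable M (count_space {p. p permutes {1..n}}) \<and>
     distr M (count_space {p. p permutes {1..n}}) \<sigma> = uniform_count_measure {p. p permutes {1..n}}"

definition sample :: "(nat \<Rightarrow> real) \<Rightarrow> ('a \<Rightarrow> nat \<Rightarrow> nat) \<Rightarrow> nat \<Rightarrow> 'a \<Rightarrow> real" where
  "sample x \<sigma> i \<omega> = x (\<sigma> \<omega> i)"

text \<open>The sigma-field generated by \<open>X 1, \<dots>, X k\<close>. A supremum of vimage algebras over \<open>{1..k}\<close>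
  would have empty carrier space at \<open>k = 0\<close>; this form gives the trivial sigma-field there.\<close>
definition generated_filtration ::
  "'a measure \<Rightarrow> (nat \<Rightarrow> 'a \<Rightarrow> real) \<Rightarrow> nat \<Rightarrow> 'a measure" where
  "generated_filtration M X k =
     sigma (space M) {X i -` B \<inter> space M | i B. i \<in> {1..k} \<and> B \<in> sets borel}"

lemma space_generated_filtration: "space (generated_filtration M X k) = space M"
  by (auto simp: generated_filtration_def intro!: space_measure_of)

lemma sets_generated_filtration_0: "sets (generated_filtration M X 0) = {{}, space M}"
  by (simp add: generated_filtration_def sigma_sets_empty_eq)

text \<open>Martingales indexed by a subset \<open>T\<close> of a linear order; the requirement that \<open>F\<close> is a
  filtration of \<open>M\<close> along \<open>T\<close> is part of the notion.\<close>
definition martingale_on ::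
  "'a measure \<Rightarrow> 't::linorder set \<Rightarrow> ('t \<Rightarrow> 'a measure) \<Rightarrow> ('t \<Rightarrow> 'a \<Rightarrow> real) \<Rightarrow> bool" where
  "martingale_on M T F Z \<longleftrightarrow>
     (\<forall>t\<in>T. subalgebra M (F t)) \<and>
     (\<forall>s\<in>T. \<forall>t\<in>T. s \<le> t \<longrightarrow> sets (F s) \<subseteq> sets (F t)) \<and>
     (\<forall>t\<in>T. Z t \<in> borel_measurable (F t)) \<and>
     (\<forall>t\<in>T. integrable M (Z t)) \<and>
     (\<forall>s\<in>T. \<forall>t\<in>T. s \<le> t \<longrightarrow> (AE \<omega> in M. real_cond_exp M (F s) (Z t) \<omega> = Z s \<omega>))"

end

(* Conditionally on F_k, all not yet drawn values X_j (j > k) have the same mean, because composing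
   the permutation with the transposition of k+1 and j leaves both the uniform distribution and
   every event of F_k invariant.  Since these values sum to -S_k, this common mean is -S_k/(n-k).
   The increment M_{k+1} - M_k factors as an F_k-measurable coefficient times
   X_{k+1} + S_k/(n-k), so its conditional mean vanishes. *)
theory Submission
  imports Defs
begin

text \<open>A function on a finite carrier takes finitely many values, so measurability already
  gives boundedness. This settles every integrability question below without any bound on the
  \<open>a k\<close>.\<close>

lemma (in finite_measure) integrable_finite_space:
  fixes f :: "'a \<Rightarrow> real"
  assumes "finite (space M)" and "f \<in> borel_measurable M"
  shows "integrable M f"
proof (rule integrable_const_bound)
  show "AE \<omega> in M. norm (f \<omega>) \<le> Max ((\<lambda>\<omega>. norm (f \<omega>)) ` space M)"
    using assms(1) by (intro AE_I2 Max_ge) auto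
qed (fact assms(2))

section \<open>The filtration generated by the sample\<close>

lemma sets_generated_filtration:
  "sets (generated_filtration M X k) =
     sigma_sets (space M) {X i -` B \<inter> space M | i B. i \<in> {1..k} \<and> B \<in> sets borel}"
  unfolding generated_filtration_def by (rule sets_measure_of) auto

lemma measurable_generated_filtration:
  assumes "i \<in> {1..k}"
  shows "X i \<in> borel_measurable (generated_filtration M X k)"
proof (rule measurableI)
  fix B :: "real set" assume "B \<in> sets borel"
  then show "X i -` B \<inter> space (generated_filtration M X k) \<in> sets (generated_filtration M X k)"
    using assms unfolding sets_generated_filtration space_generated_filtration by blast
qed simp

lemma sets_generated_filtration_mono:
  assumes "k \<le> l"
  shows "sets (generated_filtration M X k) \<subseteq> sets (generated_filtration M X l)"
proof -
  have "{X i -` B \<inter> space M | i B. i \<in> {1..k} \<and> B \<in> sets borel}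
      \<subseteq> {X i -` B \<inter> space M | i B. i \<in> {1..l} \<and> B \<in> sets borel}"
    using assms by fastforce
  then show ?thesis
    unfolding sets_generated_filtration by (rule sigma_sets_mono')
qed

lemma subalgebra_generated_filtration:
  assumes "\<And>i. i \<in> {1..k} \<Longrightarrow> X i \<in> borel_measurable M"
  shows "subalgebra M (generated_filtration M X k)"
proof -
  have "sets (generated_filtration M X k) \<subseteq> sets M"
    unfolding sets_generated_filtration
    using assms by (intro sets.sigma_sets_subset) (auto intro: measurable_sets)
  then show ?thesis
    by (simp add: subalgebra_def space_generated_filtration)
qed

text \<open>A generator of the k-th sigma-field depends on the permutation only through its value at
  some l in {1..k}, and the transposition of i, j > k fixes l. Being the preimage of an invariant
  \<open>P\<close> survives complements and countable unions. Letting \<open>P\<close> contain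
  arbitrary maps, not only permutations, makes the complement case a plain
  \<open>- P\<close>.\<close>

lemma generated_filtration_sample_invariant:
  assumes "A \<in> sets (generated_filtration M (sample x \<sigma>) k)"
    and "k < i" "k < j"
  obtains P where "A = \<sigma> -` P \<inter> space M" "\<And>p. p \<circ> Transposition.transpose i j \<in> P \<longleftrightarrow> p \<in> P"
proof -
  have "\<exists>P. A = \<sigma> -` P \<inter> space M \<and> (\<forall>p. p \<circ> Transposition.transpose i j \<in> P \<longleftrightarrow> p \<in> P)"
    using assms(1) unfolding sets_generated_filtration
  proof (induction rule: sigma_sets.induct)
    case (Basic A)
    then obtain l B where lB: "A = sample x \<sigma> l -` B \<inter> space M" "l \<in> {1..k}" by blast
    then have "Transposition.transpose i j l = l"
      using assms(2,3) by (intro transpose_apply_other) auto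
    then show ?case
      using lB by (intro exI[of _ "{p. x (p l) \<in> B}"]) (auto simp: sample_def)
  next
    case Empty
    show ?case by (intro exI[of _ "{}"]) auto
  next
    case (Compl A)
    then obtain P where "A = \<sigma> -` P \<inter> space M" "\<forall>p. p \<circ> Transposition.transpose i j \<in> P \<longleftrightarrow> p \<in> P" by blast
    then have "space M - A = \<sigma> -` (- P) \<inter> space M"
      and "\<forall>p. p \<circ> Transposition.transpose i j \<in> - P \<longleftrightarrow> p \<in> - P"
      by blast+
    then show ?case by blast
  next
    case (Union A)
    then obtain P where
      "\<And>m. A m = \<sigma> -` P m \<inter> space M" "\<And>m p. p \<circ> Transposition.transpose i j \<in> P m \<longleftrightarrow> p \<in> P m"
      by metis
    then have "(\<Union>m. A m) = \<sigma> -` (\<Union>m. P m) \<inter> space M"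
      and "\<forall>p. p \<circ> Transposition.transpose i j \<in> (\<Union>m. P m) \<longleftrightarrow> p \<in> (\<Union>m. P m)"
      by blast+
    then show ?case by blast
  qed
  then show ?thesis using that by blast
qed

section \<open>Integrals over a uniform random permutation\<close>

lemma measurable_sample:
  assumes "uniform_random_permutation M n \<sigma>"
  shows "sample x \<sigma> i \<in> borel_measurable M"
proof -
  have "\<sigma> \<in> measurable M (count_space {p. p permutes {1..n}})"
    using assms by (simp add: uniform_random_permutation_def)
  from measurable_compose[OF this, of "\<lambda>p. x (p i)" borel] show ?thesis
    by (simp add: sample_def[abs_def])
qed

text \<open>Passing to the distribution of \<sigma> turns expectations into finite averages over the
  n! permutations, where symmetry becomes reindexing of a sum.\<close>

lemma uniform_random_permutation_integral:
  fixes f :: "(nat \<Rightarrow> nat) \<Rightarrow> real"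
  assumes "uniform_random_permutation M n \<sigma>"
  shows "(\<integral>\<omega>. f (\<sigma> \<omega>) \<partial>M) = (\<Sum>p | p permutes {1..n}. f p) / fact n"
proof -
  let ?P = "{p. p permutes {1..n}}"
  have fin: "finite ?P" by (simp add: finite_permutations)
  have \<sigma>: "\<sigma> \<in> measurable M (count_space ?P)"
    and distr: "distr M (count_space ?P) \<sigma> = uniform_count_measure ?P"
    using assms by (simp_all add: uniform_random_permutation_def)
  have "(\<integral>\<omega>. f (\<sigma> \<omega>) \<partial>M) = (\<integral>p. f p \<partial>distr M (count_space ?P) \<sigma>)"
    by (rule integral_distr[symmetric, OF \<sigma>]) simp
  also have "\<dots> = (\<Sum>p\<in>?P. f p) / fact n"
    unfolding distr uniform_count_measure_def
    using fin by (simp add: lebesgue_integral_point_measure_finite card_permutations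
        sum_divide_distrib)
  finally show ?thesis .
qed

lemma sample_set_integral_exchange:
  assumes "uniform_random_permutation M n \<sigma>"
    and "A \<in> sets (generated_filtration M (sample x \<sigma>) k)"
    and i: "i \<in> {k<..n}" and j: "j \<in> {k<..n}"
  shows "(\<integral>\<omega>\<in>A. sample x \<sigma> i \<omega> \<partial>M) = (\<integral>\<omega>\<in>A. sample x \<sigma> j \<omega> \<partial>M)"
proof -
  from i j have "k < i" "k < j" by auto
  from generated_filtration_sample_invariant[OF assms(2) this]
  obtain P where A: "A = \<sigma> -` P \<inter> space M"
    and P: "\<And>p. p \<circ> Transposition.transpose i j \<in> P \<longleftrightarrow> p \<in> P" by metis
  have int: "(\<integral>\<omega>\<in>A. sample x \<sigma> l \<omega> \<partial>M)
      = (\<Sum>p | p permutes {1..n}. indicator P p * x (p l)) / fact n" for l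
  proof -
    have "(\<integral>\<omega>\<in>A. sample x \<sigma> l \<omega> \<partial>M) = (\<integral>\<omega>. indicator P (\<sigma> \<omega>) * x (\<sigma> \<omega> l) \<partial>M)"
      unfolding set_lebesgue_integral_def A
      by (intro Bochner_Integration.integral_cong) (auto simp: sample_def indicator_def)
    then show ?thesis
      using uniform_random_permutation_integral[OF assms(1), of "\<lambda>p. indicator P p * x (p l)"]
      by simp
  qed
  have \<tau>: "Transposition.transpose i j permutes {1..n}"
    using i j by (intro permutes_swap_id) auto
  have "(\<Sum>p | p permutes {1..n}. indicator P p * x (p i))
      = (\<Sum>p | p permutes {1..n}. indicator P (p \<circ> Transposition.transpose i j) * x ((p \<circ> Transposition.transpose i j) i))"
    by (rule sum_permutations_compose_right[OF \<tau>])
  also have "\<dots> = (\<Sum>p | p permutes {1..n}. indicator P p * x (p j))"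
    \<comment> \<open>The composition must stay folded while the invariance \<open>P\<close> is
      applied; only then is it unfolded, so that the swap turns \<open>p\<close> at i into
      \<open>p\<close> at j.\<close>
    by (simp add: P indicator_def del: o_apply) (simp add: o_def)
  finally show ?thesis by (simp add: int)
qed

section \<open>Centring of the next draw\<close>

lemma sample_sum_eq_0:
  assumes "uniform_random_permutation M n \<sigma>" and "(\<Sum>i=1..n. x i) = 0" and "\<omega> \<in> space M"
  shows "(\<Sum>i=1..n. sample x \<sigma> i \<omega>) = (0 :: real)"
proof -
  \<comment> \<open>Measurability into the count space on permutations gives this at every point, so
    the sum vanishes everywhere and not merely almost surely.\<close>
  have "\<sigma> \<omega> permutes {1..n}"
    using assms(1,3) by (auto simp: uniform_random_permutation_def dest: measurable_space)
  from sum.permute[OF this, of x] show ?thesis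
    using assms(2) by (simp add: sample_def o_def)
qed

lemma sample_set_integral_centred:
  assumes M: "prob_space M" "finite (space M)"
    and \<sigma>: "uniform_random_permutation M n \<sigma>"
    and sum0: "(\<Sum>i=1..n. x i) = 0" and "k < n"
    and A: "A \<in> sets (generated_filtration M (sample x \<sigma>) k)"
  shows "(\<integral>\<omega>\<in>A. (sample x \<sigma> (Suc k) \<omega> + (\<Sum>i=1..k. sample x \<sigma> i \<omega>) / (real n - real k)) \<partial>M) = 0"
proof -
  interpret prob_space M by fact
  let ?X = "sample x \<sigma>"
  let ?S = "\<lambda>\<omega>. \<Sum>i=1..k. ?X i \<omega>"
  have meas [measurable]: "?X i \<in> borel_measurable M" for i by (rule measurable_sample[OF \<sigma>])
  have "subalgebra M (generated_filtration M ?X k)"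
    by (intro subalgebra_generated_filtration meas)
  then have [measurable]: "A \<in> sets M" using A by (auto simp: subalgebra_def)
  have int: "set_integrable M A f" if "f \<in> borel_measurable M" for f :: "'a \<Rightarrow> real"
    unfolding set_integrable_def using that
    by (intro integrable_finite_space[OF M(2)]) measurable
  \<comment> \<open>The n - k undrawn values have equal integrals over \<open>A\<close>, so n - k
    copies of the first one can stand for all of them. Together with \<open>?S\<close> they make up
    the full sample, whose sum is 0; since k < n, the result may be divided by n - k.\<close>
  have "(\<integral>\<omega>\<in>A. ?S \<omega> \<partial>M) + (real n - real k) * (\<integral>\<omega>\<in>A. ?X (Suc k) \<omega> \<partial>M)
      = (\<integral>\<omega>\<in>A. ?S \<omega> \<partial>M) + (\<Sum>i\<in>{k<..n}. \<integral>\<omega>\<in>A. ?X i \<omega> \<partial>M)"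
  proof -
    have "(\<Sum>i\<in>{k<..n}. \<integral>\<omega>\<in>A. ?X i \<omega> \<partial>M) = (\<Sum>i\<in>{k<..n}. \<integral>\<omega>\<in>A. ?X (Suc k) \<omega> \<partial>M)"
      using \<open>k < n\<close> by (intro sum.cong refl sample_set_integral_exchange[OF \<sigma> A]) auto
    then show ?thesis using \<open>k < n\<close> by (simp add: of_nat_diff)
  qed
  also have "\<dots> = (\<integral>\<omega>\<in>A. ?S \<omega> + (\<Sum>i\<in>{k<..n}. ?X i \<omega>) \<partial>M)"
  proof -
    have "(\<integral>\<omega>\<in>A. (\<Sum>i\<in>{k<..n}. ?X i \<omega>) \<partial>M) = (\<Sum>i\<in>{k<..n}. \<integral>\<omega>\<in>A. ?X i \<omega> \<partial>M)"
      using int[OF meas] unfolding set_lebesgue_integral_def set_integrable_def scaleR_sum_right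
      by (intro Bochner_Integration.integral_sum)
    then show ?thesis
      by (subst set_integral_add(2)) (auto intro!: int)
  qed
  also have "\<dots> = (\<integral>\<omega>\<in>A. 0 \<partial>M)"
  proof -
    have "?S \<omega> + (\<Sum>i\<in>{k<..n}. ?X i \<omega>) = 0" if "\<omega> \<in> space M" for \<omega>
    proof -
      have "{1..n} = {1..k} \<union> {k<..n}" using \<open>k < n\<close> by auto
      then have "(\<Sum>i=1..n. ?X i \<omega>) = ?S \<omega> + (\<Sum>i\<in>{k<..n}. ?X i \<omega>)"
        by (simp add: sum.union_disjoint disjoint_iff)
      then show ?thesis using sample_sum_eq_0[where x=x, OF \<sigma> sum0 that] by simp
    qed
    then show ?thesis
      unfolding set_lebesgue_integral_def by (intro Bochner_Integration.integral_cong) auto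
  qed
  finally have "(\<integral>\<omega>\<in>A. ?S \<omega> \<partial>M) + (real n - real k) * (\<integral>\<omega>\<in>A. ?X (Suc k) \<omega> \<partial>M) = 0"
    by simp
  moreover have "(\<integral>\<omega>\<in>A. (?X (Suc k) \<omega> + ?S \<omega> / (real n - real k)) \<partial>M)
      = (\<integral>\<omega>\<in>A. ?X (Suc k) \<omega> \<partial>M) + (\<integral>\<omega>\<in>A. ?S \<omega> \<partial>M) / (real n - real k)"
    by (subst set_integral_add(2)) (auto intro!: int)
  ultimately show ?thesis
    using \<open>k < n\<close> by (simp add: field_simps)
qed

lemma cond_exp_sample_centred:
  assumes M: "prob_space M" "finite (space M)"
    and \<sigma>: "uniform_random_permutation M n \<sigma>"
    and sum0: "(\<Sum>i=1..n. x i) = 0" and "k < n"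
  shows "AE \<omega> in M. real_cond_exp M (generated_filtration M (sample x \<sigma>) k)
    (\<lambda>\<omega>. sample x \<sigma> (Suc k) \<omega> + (\<Sum>i=1..k. sample x \<sigma> i \<omega>) / (real n - real k)) \<omega> = 0"
proof -
  interpret prob_space M by fact
  let ?F = "generated_filtration M (sample x \<sigma>) k"
  have meas [measurable]: "sample x \<sigma> i \<in> borel_measurable M" for i
    by (rule measurable_sample[OF \<sigma>])
  have "subalgebra M ?F" by (intro subalgebra_generated_filtration meas)
  then interpret finite_measure_subalgebra M ?F by unfold_locales
  show ?thesis
  proof (rule real_cond_exp_charact)
    fix A assume "A \<in> sets ?F"
    from sample_set_integral_centred[OF assms this]
    show "(\<integral>\<omega>\<in>A. (sample x \<sigma> (Suc k) \<omega> + (\<Sum>i=1..k. sample x \<sigma> i \<omega>) / (real n - real k)) \<partial>M)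
        = (\<integral>\<omega>\<in>A. 0 \<partial>M)"
      by simp
  qed (auto intro!: integrable_finite_space[OF M(2)])
qed

section \<open>A one-step criterion for martingales on an interval of naturals\<close>

lemma martingale_on_natI:
  fixes Z :: "nat \<Rightarrow> 'a \<Rightarrow> real"
  assumes "finite_measure M"
    and sub: "\<And>t. t \<in> {m..<n} \<Longrightarrow> subalgebra M (F t)"
    and mono: "\<And>s t. m \<le> s \<Longrightarrow> s \<le> t \<Longrightarrow> t < n \<Longrightarrow> sets (F s) \<subseteq> sets (F t)"
    and meas: "\<And>t. t \<in> {m..<n} \<Longrightarrow> Z t \<in> borel_measurable (F t)"
    and int: "\<And>t. t \<in> {m..<n} \<Longrightarrow> integrable M (Z t)"
    and step: "\<And>t A. m \<le> t \<Longrightarrow> Suc t < n \<Longrightarrow> A \<in> sets (F t) \<Longrightarrow>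
      (\<integral>\<omega>\<in>A. Z (Suc t) \<omega> \<partial>M) = (\<integral>\<omega>\<in>A. Z t \<omega> \<partial>M)"
  shows "martingale_on M {m..<n} F Z"
proof -
  have "AE \<omega> in M. real_cond_exp M (F s) (Z t) \<omega> = Z s \<omega>"
    if st: "s \<in> {m..<n}" "t \<in> {m..<n}" "s \<le> t" for s t
  proof -
    interpret finite_measure M by fact
    interpret finite_measure_subalgebra M "F s"
      using sub[OF st(1)] by unfold_locales
    show ?thesis
    proof (rule real_cond_exp_charact)
      \<comment> \<open>The one-step equalities are chained: a set of \<open>F s\<close> stays in
        every later \<open>F t\<close>, so each step applies to the same \<open>A\<close>.
        Conditional expectations enter only through their characterisation by integrals over such
        sets.\<close>
      fix A assume A: "A \<in> sets (F s)"
      from st(3,2) show "(\<integral>\<omega>\<in>A. Z t \<omega> \<partial>M) = (\<integral>\<omega>\<in>A. Z s \<omega> \<partial>M)"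
      proof (induction t rule: dec_induct)
        case (step t)
        then have "A \<in> sets (F t)" using A mono[of s t] st(1) by auto
        then show ?case using step assms(6)[of t A] st(1) by simp
      qed simp
    qed (use st int meas in auto)
  qed
  then show ?thesis
    unfolding martingale_on_def using sub mono meas int by auto
qed

theorem mainTheorem2:
  fixes n :: nat and x :: "nat \<Rightarrow> real" and M :: "'a measure"
    and \<sigma> :: "'a \<Rightarrow> nat \<Rightarrow> nat" and a :: "nat \<Rightarrow> 'a \<Rightarrow> real"
    and X S W :: "nat \<Rightarrow> 'a \<Rightarrow> real" and F :: "nat \<Rightarrow> 'a measure"
  assumes "n \<ge> 2"
    and "(\<Sum>i=1..n. x i) = 0"
    and "prob_space M" and "finite (space M)"
    and "uniform_random_permutation M n \<sigma>"
    and "X = sample x \<sigma>"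
    and "F = generated_filtration M X"
    and "\<And>k. k \<in> {1..n} \<Longrightarrow> a k \<in> borel_measurable (F (k - 1))"
    and "S = (\<lambda>k \<omega>. \<Sum>i=1..k. X i \<omega>)"
    and "W = (\<lambda>k \<omega>. \<Sum>i=1..k. a i \<omega> * X i \<omega>)"
  shows "martingale_on M {1..<n} F
           (\<lambda>k \<omega>. W k \<omega> + (\<Sum>i=1..k. a i \<omega>) / (real n - real k) * S k \<omega>)"
proof -
  interpret prob_space M by fact
  have X_M [measurable]: "X i \<in> borel_measurable M" for i
    unfolding assms(6) by (rule measurable_sample[OF assms(5)])
  have sub: "subalgebra M (F k)" for k
    unfolding assms(7) by (intro subalgebra_generated_filtration X_M)
  have mono: "sets (F k) \<subseteq> sets (F l)" if "k \<le> l" for k l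
    unfolding assms(7) by (rule sets_generated_filtration_mono[OF that])
  have X_F: "X i \<in> borel_measurable (F k)" if "i \<in> {1..k}" for i k
    unfolding assms(7) by (rule measurable_generated_filtration[OF that])
  \<comment> \<open>The bound \<open>Suc k\<close> is where predictability enters: the coefficient
    of the next draw is already known at time k.\<close>
  have a_F: "a i \<in> borel_measurable (F k)" if "i \<in> {1..n}" "i \<le> Suc k" for i k
  proof -
    have "subalgebra (F k) (F (i - 1))"
      using mono[of "i - 1" k] that(2)
      by (simp add: subalgebra_def assms(7) space_generated_filtration)
    then show ?thesis by (rule measurable_from_subalg) (fact assms(8)[OF that(1)])
  qed
  let ?Z = "\<lambda>k \<omega>. W k \<omega> + (\<Sum>i=1..k. a i \<omega>) / (real n - real k) * S k \<omega>"
  have Z_F: "?Z k \<in> borel_measurable (F k)" if "k \<in> {1..<n}" for k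
    unfolding assms(9,10) using that
    by (intro borel_measurable_add borel_measurable_times borel_measurable_divide
        borel_measurable_sum borel_measurable_const X_F a_F) auto
  have Z_int: "integrable M (?Z k)" if "k \<in> {1..<n}" for k
    using measurable_from_subalg[OF sub Z_F[OF that]]
    by (rule integrable_finite_space[OF assms(4)])
  show ?thesis
  proof (rule martingale_on_natI)
    fix k A assume k: "1 \<le> k" "Suc k < n" and A: "A \<in> sets (F k)"
    interpret finite_measure_subalgebra M "F k"
      using sub by unfold_locales
    \<comment> \<open>The coefficient of the increment, with the indicator of \<open>A\<close>
      absorbed so that integrating over \<open>A\<close> becomes integrating \<open>c\<close> times
      \<open>Y\<close> over the whole space.\<close>
    define c where "c \<omega> = indicator A \<omega> *
      (a (Suc k) \<omega> + (\<Sum>i=1..Suc k. a i \<omega>) / (real n - real (Suc k)))" for \<omega>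
    define Y where "Y \<omega> = X (Suc k) \<omega> + S k \<omega> / (real n - real k)" for \<omega>
    have incr: "indicator A \<omega> * ?Z (Suc k) \<omega> - indicator A \<omega> * ?Z k \<omega> = c \<omega> * Y \<omega>" for \<omega>
    proof -
      define d where "d = real n - real k - 1"
      have d: "d \<noteq> 0" "d + 1 \<noteq> 0" "real n - real (Suc k) = d" "real n - real k = d + 1"
        using k by (auto simp: d_def)
      \<comment> \<open>Here u is the indicator of \<open>A\<close>, w is W_k, b is a_(k+1), y is
        X_(k+1), s is a_1 + ... + a_k and t is S_k. Both denominators are nonzero because k + 1 <
        n.\<close>
      have *: "u * (w + b * y + (s + b) / d * (t + y)) - u * (w + s / (d + 1) * t)
          = u * (b + (s + b) / d) * (y + t / (d + 1))" for u w b y s t :: real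
      proof -
        \<comment> \<open>Expressing s and t through the quotients p and q removes the divisions and
          leaves a polynomial identity.\<close>
        define p q where "p = (s + b) / d" and "q = t / (d + 1)"
        have s: "s = p * d - b" and t: "t = q * (d + 1)"
          using d(1,2) by (simp_all add: p_def q_def)
        have "s / (d + 1) * t = (p * d - b) * q" by (simp add: q_def flip: s)
        moreover have "u * (w + b * y + p * (t + y)) - u * (w + (p * d - b) * q)
            = u * (b + p) * (y + q)"
          unfolding t by (simp add: algebra_simps)
        ultimately show ?thesis
          by (simp only: p_def[symmetric] q_def[symmetric])
      qed
      show ?thesis
        unfolding c_def Y_def assms(9,10) d(3,4) using * by simp
    qed
    have c_F: "c \<in> borel_measurable (F k)"
      unfolding c_def using k A
      by (intro borel_measurable_add borel_measurable_times borel_measurable_divide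
          borel_measurable_sum borel_measurable_const borel_measurable_indicator a_F) auto
    have Y_M: "Y \<in> borel_measurable M"
      unfolding Y_def assms(9) by measurable
    have "AE \<omega> in M. real_cond_exp M (F k) Y \<omega> = 0"
      using cond_exp_sample_centred[OF assms(3,4,5,2), of k] k
      by (simp add: Y_def[abs_def] assms(6,7,9))
    then have "(\<integral>\<omega>. c \<omega> * real_cond_exp M (F k) Y \<omega> \<partial>M) = (\<integral>\<omega>. 0 \<partial>M)"
      using measurable_from_subalg[OF sub c_F] by (intro integral_cong_AE) auto
    \<comment> \<open>Since \<open>c\<close> is measurable for \<open>F k\<close>, \<open>Y\<close>
      may be replaced by its conditional expectation under the integral, and that vanishes almost
      everywhere.\<close>
    moreover have "(\<integral>\<omega>. c \<omega> * real_cond_exp M (F k) Y \<omega> \<partial>M) = (\<integral>\<omega>. c \<omega> * Y \<omega> \<partial>M)"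
      using c_F Y_M measurable_from_subalg[OF sub c_F]
      by (intro real_cond_exp_intg(2) integrable_finite_space[OF assms(4)]) auto
    moreover have int: "integrable M (\<lambda>\<omega>. indicator A \<omega> * ?Z l \<omega>)" if "l \<in> {1..<n}" for l
      using integrable_mult_indicator[OF _ Z_int[OF that], of A] A sub[of k]
      by (auto simp: subalgebra_def)
    have "(\<integral>\<omega>. c \<omega> * Y \<omega> \<partial>M)
        = (\<integral>\<omega>. indicator A \<omega> * ?Z (Suc k) \<omega> \<partial>M) - (\<integral>\<omega>. indicator A \<omega> * ?Z k \<omega> \<partial>M)"
      unfolding incr[symmetric] using k by (intro Bochner_Integration.integral_diff int) auto
    ultimately show "(\<integral>\<omega>\<in>A. ?Z (Suc k) \<omega> \<partial>M) = (\<integral>\<omega>\<in>A. ?Z k \<omega> \<partial>M)"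
      by (simp add: set_lebesgue_integral_def)
  qed (use sub mono Z_F Z_int in \<open>auto intro: finite_measure_axioms\<close>)
qed

end
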